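(* Let $-1\le A<B\le 1$, $\alpha\in[0,1)$, $\beta\in(-\frac\pi2,\frac\pi2)$ and $g(\xi)=\frac{1+A\xi}{1+B\xi}$, $\xi\in\mathbb D$. If $F\in\widehat{\mathcal S}_g^{\alpha,\beta}(\mathbb B^n)$, then for every $z\in\mathbb B^n\setminus\{0\}$ there exists a unit vector $v(z)=\dfrac{[J_F(z)]^{-1}F(z)}{\|[J_F(z)]^{-1}F(z)\|}$ such that $$\|J_F(z)v(z)\|\le\begin{cases}\dfrac{[1+(A-A\alpha+B\alpha)\|z\|]^{\frac{(B-A)(1-\alpha)}{A-A\alpha+B\alpha}}}{\left(\frac{1+A\|z\|}{1+B\|z\|}-\frac{1}{1-\alpha}\sqrt{\alpha^2+\tan^2\beta}\right)(1-\alpha)\cos\beta}, & A-A\alpha+B\alpha\ne0,\\[5mm] \dfrac{e^{(B-A)(1-\alpha)\|z\|}}{\left(\frac{1+A\|z\|}{1+B\|z\|}-\frac{1}{1-\alpha}\sqrt{\alpha^2+\tan^2\beta}\right)(1-\alpha)\cos\beta}, & A-A\alpha+B\alpha=0.\end{cases}$$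
   Context: $\mathbb B^n$ is the open Euclidean unit ball of $\mathbb C^n$ with inner product $\langle z,w\rangle=\sum_j z_j\overline{w_j}$ and norm $\|z\|=\sqrt{\langle z,z\rangle}$; $\mathbb D=\mathbb B^1$. $H(\mathbb B^n)$ is the set of holomorphic mappings $\mathbb B^n\to\mathbb C^n$; $J_f(z)$ is the complex Jacobian matrix of $f$ at $z$; $I_n$ is the identity matrix. For $\alpha\in[0,1)$, $\beta\in(-\frac\pi2,\frac\pi2)$, with $i=\sqrt{-1}$, $\widetilde{\mathcal M}_g^{\alpha,\beta}$ is the set of $h\in H(\mathbb B^n)$ with $h(0)=0$, $J_h(0)=I_n$ and $$\frac{-\alpha+i\tan\beta}{1-\alpha}+\frac{1-i\tan\beta}{1-\alpha}\left\langle h(z),\frac{z}{\|z\|^2}\right\rangle\in g(\mathbb D)\quad\text{for all } z\in\mathbb B^n\setminus\{0\}.$$ $\widehat{\mathcal S}_g^{\alpha,\beta}(\mathbb B^n)$ is the set of $f\in H(\mathbb B^n)$ with $f(0)=0$, $J_f(0)=I_n$, $J_f(z)$ nonsingular at every $z\in\mathbb B^n$, such that the mapping $z\mapsto [J_f(z)]^{-1}f(z)$ belongs to $\widetilde{\mathcal M}_g^{\alpha,\beta}$.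
   Formalization: The norm inequality is claimed only at those z where (1+A‖z‖)/(1+B‖z‖) − √(α²+tan²β)/(1−α) > 0; elsewhere the printed bound is negative or undefined (e.g. A=−1, B=1, α=0, β=π/4, F=identity). *)

theory Defs
  imports "HOL-Analysis.Analysis"
begin

text \<open>
  \<open>\<complex>\<^sup>n\<close> is the type \<open>complex ^ 'n\<close>; its library norm is the Euclidean (Hermitian) one, so the
  unit ball \<open>\<bool>\<^sup>n\<close> is \<open>ball 0 1\<close>. The library inner product on this type is only the real part of
  the Hermitian product, which is therefore introduced here (linear in the first argument).
\<close>

definition hinner :: "complex ^ 'n \<Rightarrow> complex ^ 'n \<Rightarrow> complex" where
  "hinner z w = (\<Sum>j\<in>UNIV. z $ j * cnj (w $ j))"

lemma hinner_self: "hinner z z = of_real ((norm z)\<^sup>2)"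
  by (simp add: hinner_def norm_vec_def L2_set_def sum_nonneg complex_norm_square[symmetric]
      flip: of_real_power of_real_sum)

text \<open>
  Holomorphy in several variables: the real Frechet derivative exists and is complex linear.
  For such maps the library's \<open>jacobian f (at z)\<close>, taken with complex entries, is the
  complex Jacobian matrix \<open>(\<partial>f\<^sub>j/\<partial>z\<^sub>k)\<close>, as the next two lemmas confirm.
\<close>

definition holomorphic_map_on :: "(complex ^ 'n \<Rightarrow> complex ^ 'm) \<Rightarrow> (complex ^ 'n) set \<Rightarrow> bool" where
  "holomorphic_map_on f S \<longleftrightarrow>
     (\<forall>z\<in>S. \<exists>M :: complex ^ 'n ^ 'm. (f has_derivative (\<lambda>h. M *v h)) (at z))"

lemma holomorphic_map_jacobian:
  assumes "holomorphic_map_on f S" "z \<in> S"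
  shows "(f has_derivative (\<lambda>h. jacobian f (at z) *v h)) (at z)"
proof -
  obtain M where M: "(f has_derivative (\<lambda>h. M *v h)) (at z)"
    using assms unfolding holomorphic_map_on_def by blast
  then have "frechet_derivative f (at z) = (\<lambda>h. M *v h)"
    by (rule frechet_derivative_at[symmetric])
  then have "jacobian f (at z) = M"
    by (simp add: jacobian_def)
  with M show ?thesis by simp
qed

lemma jacobian_nth_nth:
  assumes "holomorphic_map_on f S" "z \<in> S"
  shows "jacobian f (at z) $ j $ k = deriv (\<lambda>\<zeta>. f (z + \<zeta> *s axis k 1) $ j) 0"
proof -
  let ?J = "jacobian f (at z)"
  have f: "(f has_derivative (\<lambda>h. ?J *v h)) (at (z + 0 *s axis k 1))"
    using holomorphic_map_jacobian[OF assms] by simp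
  have "bounded_linear (\<lambda>\<zeta>::complex. \<zeta> *s axis k (1::complex))"
    by (rule linear_conv_bounded_linear[THEN iffD1])
       (auto intro!: linearI simp: vec_eq_iff algebra_simps)
  then have l: "((\<lambda>\<zeta>. z + \<zeta> *s axis k 1) has_derivative (\<lambda>\<zeta>. \<zeta> *s axis k 1)) (at 0)"
    by (auto intro!: derivative_eq_intros bounded_linear_imp_has_derivative)
  have "((\<lambda>\<zeta>. f (z + \<zeta> *s axis k 1) $ j) has_derivative
          (\<lambda>\<zeta>. (?J *v (\<zeta> *s axis k 1)) $ j)) (at 0)"
    using has_derivative_compose[OF l f] by (rule bounded_linear.has_derivative[OF bounded_linear_vec_nth])
  moreover have "(\<lambda>\<zeta>. (?J *v (\<zeta> *s axis k 1)) $ j) = (*) (?J $ j $ k)"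
    by (simp add: fun_eq_iff matrix_vector_mult_def axis_def if_distrib cong: if_cong)
  ultimately have "((\<lambda>\<zeta>. f (z + \<zeta> *s axis k 1) $ j) has_field_derivative ?J $ j $ k) (at 0)"
    by (simp add: has_field_derivative_def)
  then show ?thesis by (simp add: DERIV_imp_deriv)
qed

definition M_class :: "(complex \<Rightarrow> complex) \<Rightarrow> real \<Rightarrow> real \<Rightarrow> (complex ^ 'n \<Rightarrow> complex ^ 'n) set" where
  "M_class g \<alpha> \<beta> = {h. holomorphic_map_on h (ball 0 1) \<and> h 0 = 0 \<and> jacobian h (at 0) = mat 1 \<and>
     (\<forall>z \<in> ball 0 1 - {0}.
        (- of_real \<alpha> + \<i> * of_real (tan \<beta>)) / (1 - of_real \<alpha>)
        + (1 - \<i> * of_real (tan \<beta>)) / (1 - of_real \<alpha>) * hinner (h z) (z /\<^sub>R (norm z)\<^sup>2)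
        \<in> g ` ball 0 1)}"

definition S_class :: "(complex \<Rightarrow> complex) \<Rightarrow> real \<Rightarrow> real \<Rightarrow> (complex ^ 'n \<Rightarrow> complex ^ 'n) set" where
  "S_class g \<alpha> \<beta> = {f. holomorphic_map_on f (ball 0 1) \<and> f 0 = 0 \<and> jacobian f (at 0) = mat 1 \<and>
     (\<forall>z \<in> ball 0 1. invertible (jacobian f (at z))) \<and>
     (\<lambda>z. matrix_inv (jacobian f (at z)) *v f z) \<in> M_class g \<alpha> \<beta>}"

end

theory Submission
  imports Defs "HOL-Complex_Analysis.Conformal_Mappings"
begin

text \<open>
  Put \<open>h z = J\<^sub>F(z)\<inverse> F(z)\<close>, so that \<open>norm (J\<^sub>F(z) v) = norm (F z) / norm (h z)\<close>. On each complex line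
  through the origin the function in the definition of the class is subordinate to the Moebius map
  \<open>g\<close>; by the Schwarz lemma its real part is at least \<open>(1 + A r) / (1 + B r)\<close> at distance
  \<open>r = norm z\<close>. Together with the Cauchy-Schwarz inequality this bounds \<open>norm (h z)\<close> from below. It
  also controls the rate at which \<open>norm v\<close> shrinks along the spirals \<open>v' = - (1 - i tan \<beta>) h(v)\<close>,
  on which \<open>F\<close> is multiplied by \<open>exp (- (1 - i tan \<beta>) t)\<close>, and thereby bounds \<open>norm (F z)\<close> from above.
\<close>

section \<open>Hermitian product and slices along complex lines\<close>

lemma inner_eq_Re_hinner:
  fixes z w :: "complex ^ 'n"
  shows "inner z w = Re (hinner z w)"
  by (simp add: inner_vec_def hinner_def inner_complex_def)

lemma norm_hinner_le:
  fixes z w :: "complex ^ 'n"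
  shows "norm (hinner z w) \<le> norm z * norm w"
proof -
  have "norm (hinner z w) \<le> (\<Sum>j\<in>UNIV. \<bar>norm (z $ j)\<bar> * \<bar>norm (w $ j)\<bar>)"
    unfolding hinner_def by (rule order_trans[OF norm_sum]) (simp add: norm_mult)
  also have "\<dots> \<le> norm z * norm w"
    unfolding norm_vec_def by (rule L2_set_mult_ineq)
  finally show ?thesis .
qed

lemma hinner_smult_left: "hinner (a *s z) w = a * hinner z w"
  by (simp add: hinner_def sum_distrib_left mult.assoc)

lemma hinner_minus_left: "hinner (- z) w = - hinner z w"
  by (simp add: hinner_def sum_negf)

lemma hinner_smult_right: "hinner z (a *s w) = cnj a * hinner z w"
  by (simp add: hinner_def sum_distrib_left ac_simps)

lemma scaleR_eq_smult:
  fixes z :: "complex ^ 'n"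
  shows "r *\<^sub>R z = of_real r *s z"
  by (simp add: vec_eq_iff scaleR_conv_of_real[where 'a = complex])

lemma matrix_vector_mult_scaleR_complex:
  fixes M :: "complex ^ 'n ^ 'm"
  shows "M *v (r *\<^sub>R z) = r *\<^sub>R (M *v z)"
  by (simp add: scaleR_eq_smult vector_scalar_commute)

lemma norm_smult:
  fixes z :: "complex ^ 'n"
  shows "norm (a *s z) = norm a * norm z"
  by (simp add: norm_vec_def norm_mult L2_set_right_distrib)

lemma bounded_linear_hinner_left: "bounded_linear (\<lambda>z :: complex ^ 'n. hinner z w)"
  by (rule linear_conv_bounded_linear[THEN iffD1])
     (auto intro!: linearI simp: hinner_def sum.distrib scaleR_sum_right algebra_simps)

text \<open>Gives access to one-variable theory: the conjugation in \<open>hinner\<close> falls on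
  the fixed vector \<open>w\<close> only, so the paired slice of \<open>f\<close> stays complex
  differentiable.\<close>

lemma has_field_derivative_hinner_line:
  fixes f :: "complex ^ 'n \<Rightarrow> complex ^ 'm"
  assumes "holomorphic_map_on f S" "\<zeta> *s u \<in> S"
  shows "((\<lambda>\<zeta>. hinner (f (\<zeta> *s u)) w) has_field_derivative
           hinner (jacobian f (at (\<zeta> *s u)) *v u) w) (at \<zeta>)"
proof -
  let ?J = "jacobian f (at (\<zeta> *s u))"
  have "bounded_linear (\<lambda>\<zeta>::complex. \<zeta> *s u)"
    by (rule linear_conv_bounded_linear[THEN iffD1])
       (auto intro!: linearI simp: vec_eq_iff algebra_simps)
  then have l: "((\<lambda>\<zeta>. \<zeta> *s u) has_derivative (\<lambda>\<zeta>. \<zeta> *s u)) (at \<zeta>)"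
    by (rule bounded_linear_imp_has_derivative)
  have "((\<lambda>\<zeta>. hinner (f (\<zeta> *s u)) w) has_derivative (\<lambda>t. hinner (?J *v (t *s u)) w)) (at \<zeta>)"
    using has_derivative_compose[OF l holomorphic_map_jacobian[OF assms]]
    by (rule bounded_linear.has_derivative[OF bounded_linear_hinner_left])
  moreover have "(\<lambda>t. hinner (?J *v (t *s u)) w) = (*) (hinner (?J *v u) w)"
    by (simp add: fun_eq_iff hinner_smult_left vector_scalar_commute mult.commute)
  ultimately show ?thesis by (simp add: has_field_derivative_def)
qed

section \<open>Subordination to a Moebius map in one variable\<close>

lemma one_plus_mult_neq_0:
  fixes B :: real and \<xi> :: complex
  assumes "\<bar>B\<bar> \<le> 1" "norm \<xi> < 1"
  shows "1 + of_real B * \<xi> \<noteq> 0"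
proof
  assume "1 + of_real B * \<xi> = 0"
  then have "of_real B * \<xi> = - 1" by (simp add: add_eq_0_iff)
  then have "norm (of_real B * \<xi>) = 1" by simp
  then have "\<bar>B\<bar> * norm \<xi> = 1" by (simp add: norm_mult)
  moreover have "\<bar>B\<bar> * norm \<xi> \<le> 1 * norm \<xi>" using assms by (intro mult_right_mono) auto
  ultimately show False using assms by simp
qed

text \<open>After cross-multiplication the difference of the two sides is \<open>B - A\<close> times
  a sum of two nonnegative products. One vanishes when \<open>norm \<xi> = r\<close>, the other when
  \<open>\<xi>\<close> is real and nonnegative, so equality holds at
  \<open>\<xi> = r\<close>.\<close>

lemma Re_moebius_ge:
  fixes A B r :: real and \<xi> :: complex
  assumes "- 1 \<le> A" "A < B" "B \<le> 1" "norm \<xi> \<le> r" "r < 1"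
  shows "(1 + A * r) / (1 + B * r) \<le> Re ((1 + of_real A * \<xi>) / (1 + of_real B * \<xi>))"
proof -
  define x y where "x = Re \<xi>" and "y = Im \<xi>"
  have r0: "0 \<le> r" using assms(4) norm_ge_zero[of \<xi>] by linarith
  have pos: "0 < 1 + B * t" if "0 \<le> t" "t < 1" for t
  proof -
    have "- 1 * t \<le> B * t" using assms that by (intro mult_right_mono) auto
    then show ?thesis using that by simp
  qed
  have \<rho>: "(norm \<xi>)\<^sup>2 = x\<^sup>2 + y\<^sup>2" by (simp add: cmod_power2 x_def y_def)
  have xr: "x \<le> norm \<xi>" by (simp add: x_def complex_Re_le_cmod)
  have ne: "1 + of_real B * \<xi> \<noteq> 0"
    using assms by (intro one_plus_mult_neq_0) auto
  have D: "(1 + B * x)\<^sup>2 + (B * y)\<^sup>2 > 0"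
    using ne by (auto simp: complex_eq_iff x_def y_def sum_power2_gt_zero_iff)
  have "0 \<le> (B - A) * ((r - norm \<xi>) * (1 + B * norm \<xi>) + (1 - B * r) * (norm \<xi> - x))"
  proof -
    have "B * r \<le> 1 * r" using assms r0 by (intro mult_right_mono) auto
    moreover have "0 < 1 + B * norm \<xi>" using assms by (intro pos) auto
    ultimately have "0 \<le> (r - norm \<xi>) * (1 + B * norm \<xi>)" "0 \<le> (1 - B * r) * (norm \<xi> - x)"
      using assms xr by simp_all
    then show ?thesis using assms by simp
  qed
  also have "\<dots> = (B - A) * (r + x * (B * r - 1) - B * (norm \<xi>)\<^sup>2)"
    by (simp add: algebra_simps power2_eq_square)
  also have "\<dots> = ((1 + A * x) * (1 + B * x) + A * y * (B * y)) * (1 + B * r)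
               - (1 + A * r) * ((1 + B * x)\<^sup>2 + (B * y)\<^sup>2)"
    unfolding \<rho> by (simp add: algebra_simps power2_eq_square)
  finally have "(1 + A * r) / (1 + B * r)
      \<le> ((1 + A * x) * (1 + B * x) + A * y * (B * y)) / ((1 + B * x)\<^sup>2 + (B * y)\<^sup>2)"
    using D pos[OF r0 assms(5)] by (simp add: pos_divide_le_eq pos_le_divide_eq mult.commute)
  also have "\<dots> = Re ((1 + of_real A * \<xi>) / (1 + of_real B * \<xi>))"
    by (simp add: Re_divide x_def y_def)
  finally show ?thesis .
qed

text \<open>The Moebius map is injective and sends \<open>0\<close> to \<open>1 = p 0\<close>, so
  \<open>p\<close> is that map composed with a holomorphic self-map \<open>\<omega>\<close> of the
  disc fixing \<open>0\<close>. The Schwarz lemma lets \<open>Re_moebius_ge\<close> be used at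
  \<open>\<omega> \<zeta>\<close> with \<open>r = norm \<zeta>\<close>.\<close>

lemma Re_subordinate_moebius_ge:
  fixes p :: "complex \<Rightarrow> complex"
  assumes AB: "- 1 \<le> A" "A < B" "B \<le> 1"
    and p: "p holomorphic_on ball 0 1" "p 0 = 1"
    and sub: "\<And>\<zeta>. norm \<zeta> < 1 \<Longrightarrow>
      \<exists>\<xi>. norm \<xi> < 1 \<and> p \<zeta> = (1 + of_real A * \<xi>) / (1 + of_real B * \<xi>)"
    and z: "norm \<zeta> < 1"
  shows "(1 + A * norm \<zeta>) / (1 + B * norm \<zeta>) \<le> Re (p \<zeta>)"
proof -
  \<comment> \<open>The Schwarz function of \<open>p\<close>: \<open>(1 - w) / (B * w - A)\<close> inverts \<open>(1 + A * \<xi>) / (1 + B * \<xi>)\<close>.\<close>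
  define \<omega> where "\<omega> = (\<lambda>\<zeta>. (1 - p \<zeta>) / (of_real B * p \<zeta> - of_real A))"
  have key: "of_real B * p \<zeta> - of_real A \<noteq> 0" "norm (\<omega> \<zeta>) < 1"
      "p \<zeta> = (1 + of_real A * \<omega> \<zeta>) / (1 + of_real B * \<omega> \<zeta>)" if \<zeta>: "norm \<zeta> < 1" for \<zeta>
  proof -
    obtain \<xi> where \<xi>: "norm \<xi> < 1" "p \<zeta> = (1 + of_real A * \<xi>) / (1 + of_real B * \<xi>)"
      using sub[OF \<zeta>] by blast
    have ne: "1 + of_real B * \<xi> \<noteq> 0"
      using AB \<xi>(1) by (intro one_plus_mult_neq_0) auto
    \<comment> \<open>The nonzero factor common to both shows that the denominator of
      \<open>\<omega>\<close> does not vanish and that \<open>\<omega> \<zeta>\<close> is the given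
      \<open>\<xi>\<close>.\<close>
    have d: "of_real B * p \<zeta> - of_real A = of_real (B - A) / (1 + of_real B * \<xi>)"
      and n: "1 - p \<zeta> = of_real (B - A) * \<xi> / (1 + of_real B * \<xi>)"
      using ne by (simp_all add: \<xi>(2) field_simps)
    have "of_real (B - A) \<noteq> (0 :: complex)" using AB by simp
    then show "of_real B * p \<zeta> - of_real A \<noteq> 0"
      and "norm (\<omega> \<zeta>) < 1" and "p \<zeta> = (1 + of_real A * \<omega> \<zeta>) / (1 + of_real B * \<omega> \<zeta>)"
      using ne \<xi> unfolding \<omega>_def d n by (simp_all del: of_real_diff)
  qed
  have "\<omega> holomorphic_on ball 0 1"
    unfolding \<omega>_def using key(1) p(1) by (intro holomorphic_intros) auto
  moreover have "\<omega> 0 = 0" by (simp add: \<omega>_def p(2))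
  ultimately have "norm (\<omega> \<zeta>) \<le> norm \<zeta>"
    using Schwarz_Lemma(1)[of \<omega> \<zeta>] key(2) z by auto
  then show ?thesis
    using Re_moebius_ge[OF AB _ z] key(3)[OF z] by simp
qed

section \<open>Growth of \<open>F\<close> by a maximum principle\<close>

text \<open>
  The differential inequality \<open>rad\<close> says that along the spirals \<open>v' = - c *s h v\<close>, on which
  \<open>norm (F v)\<close> decays like \<open>exp (- t)\<close>, \<open>norm (F v) / (norm v * exp (K (norm v)))\<close> does not
  decrease. A maximum principle on annuli makes it unnecessary to solve this equation: after the
  perturbation by \<open>\<epsilon>\<close>, a small step in the direction \<open>- c *s h y\<close> strictly increases the quotient,
  so its maximum is attained on the inner sphere.
\<close>

lemma growth_bound:
  fixes F h :: "complex ^ 'n \<Rightarrow> complex ^ 'n" and c :: complex and K k :: "real \<Rightarrow> real"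
  assumes F: "holomorphic_map_on F (ball 0 1)" "F 0 = 0" "jacobian F (at 0) = mat 1"
    and h: "\<And>z. z \<in> ball 0 1 \<Longrightarrow> jacobian F (at z) *v h z = F z"
    and nz: "\<And>z. z \<in> ball 0 1 - {0} \<Longrightarrow> F z \<noteq> 0"
    and c: "Re c = 1"
    and K: "K 0 = 0" "\<And>r. 0 \<le> r \<Longrightarrow> r < 1 \<Longrightarrow> (K has_real_derivative k r) (at r)"
    and k: "\<And>r. 0 \<le> r \<Longrightarrow> r < 1 \<Longrightarrow> 0 \<le> k r"
    and rad: "\<And>z. z \<in> ball 0 1 - {0} \<Longrightarrow>
      (norm z)\<^sup>2 \<le> Re (c * hinner (h z) z) * (1 + norm z * k (norm z))"
    and z: "z \<in> ball 0 1 - {0}"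
  shows "norm (F z) \<le> norm z * exp (K (norm z))"
proof -
  have K0: "0 \<le> K r" if "0 \<le> r" "r < 1" for r
  proof -
    have "K 0 \<le> K r"
    proof (rule DERIV_nonneg_imp_nondecreasing[OF that(1)])
      fix s assume "0 \<le> s" "s \<le> r"
      then show "\<exists>d. (K has_real_derivative d) (at s) \<and> 0 \<le> d"
        using that(2) by (intro exI[of _ "k s"] conjI K(2) k) auto
    qed
    then show ?thesis by (simp add: K)
  qed
  \<comment> \<open>\<open>\<epsilon>\<close> has two tasks: the term
    \<open>\<epsilon> * norm z\<close> makes a derivative strictly positive, and the right-hand side
    absorbs the error of replacing \<open>F y\<close> by \<open>y\<close> near the origin.\<close>
  have pert: "ln (norm (F z)) - ln (norm z) - K (norm z) - \<epsilon> * norm z \<le> \<epsilon>" if "\<epsilon> > 0" for \<epsilon>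
  proof -
    define \<Phi> where "\<Phi> = (\<lambda>y. ln (norm (F y)) - ln (norm y) - K (norm y) - \<epsilon> * norm y)"
    have dF: "(F has_derivative (\<lambda>v. jacobian F (at y) *v v)) (at y)" if "y \<in> ball 0 1" for y
      using holomorphic_map_jacobian[OF F(1) that] .
    obtain d where d: "d > 0" "\<And>y. norm y < d \<Longrightarrow> norm (F y - y) \<le> \<epsilon> * norm y"
      using dF[of 0] \<open>\<epsilon> > 0\<close> unfolding has_derivative_at_alt F(2,3) by auto
    \<comment> \<open>\<open>d / 2\<close> keeps the inner sphere where \<open>F\<close> is close to
      the identity; the minimum with \<open>norm z\<close> keeps \<open>z\<close> in the annulus
      \<open>X\<close>, which may degenerate to a sphere.\<close>
    define \<delta> where "\<delta> = min (norm z) (d / 2)"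
    have \<delta>: "0 < \<delta>" "\<delta> \<le> norm z" "\<delta> < d" using z d by (auto simp: \<delta>_def)
    define X where "X = cball (0 :: complex ^ 'n) (norm z) - ball 0 \<delta>"
    have X: "y \<in> ball 0 1 - {0}" if "y \<in> X" for y
      using that \<delta> z by (auto simp: X_def)
    have "continuous_on X F"
      using X by (intro continuous_at_imp_continuous_on) (blast intro: has_derivative_continuous dF)
    moreover have "continuous_on {0..<1} K"
      using K(2)[THEN DERIV_isCont] by (intro continuous_at_imp_continuous_on) auto
    then have "continuous_on X (\<lambda>y. K (norm y))"
      by (rule continuous_on_compose2) (use X in \<open>auto intro!: continuous_intros\<close>)
    ultimately have "continuous_on X \<Phi>"
      unfolding \<Phi>_def using nz X by (intro continuous_intros) auto
    moreover have "compact X" unfolding X_def by (intro compact_diff) auto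
    moreover have zX: "z \<in> X" using \<delta> by (auto simp: X_def)
    ultimately obtain y where y: "y \<in> X" "\<And>x. x \<in> X \<Longrightarrow> \<Phi> x \<le> \<Phi> y"
      using continuous_attains_sup[of X \<Phi>] by blast
    have yb: "y \<in> ball 0 1 - {0}" using X y by blast
    define r where "r = norm y"
    have r: "0 < r" "r < 1" using yb by (auto simp: r_def)
    \<comment> \<open>Elsewhere, even on the outer sphere, a small step along the inward direction
      \<open>v\<close> would stay in \<open>X\<close> and increase \<open>\<Phi>\<close>.\<close>
    have "norm y = \<delta>"
    proof (rule ccontr)
      assume "norm y \<noteq> \<delta>"
      then have yd: "\<delta> < norm y" "norm y \<le> norm z" using y by (auto simp: X_def)
      define v where "v = (- c) *s h y"
      define q where "q = Re (c * hinner (h y) y)"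
      have q: "r\<^sup>2 \<le> q * (1 + r * k r)" using rad[OF yb] by (simp add: q_def r_def)
      have k0: "0 \<le> r * k r" using k[of r] r by simp
      have q0: "0 < q"
      proof (rule ccontr)
        assume "\<not> 0 < q"
        then have "q * (1 + r * k r) \<le> 0" using k0 by (simp add: mult_nonpos_nonneg)
        then show False using q r by (simp add: power2_eq_square) (smt (verit) mult_pos_pos)
      qed
      have line: "((\<lambda>s. y + s *\<^sub>R v) has_derivative (\<lambda>s. s *\<^sub>R v)) (at 0)"
        by (auto intro!: derivative_eq_intros)
      have "((\<lambda>s. norm (y + s *\<^sub>R v)) has_derivative (\<lambda>s. inner (sgn y) (s *\<^sub>R v))) (at 0)"
        using has_derivative_compose[OF line, of norm "\<lambda>h. inner (sgn y) h"] yb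
        by (simp add: has_derivative_norm inner_commute)
      moreover have "inner y v = - q"
        by (subst inner_commute)
           (simp add: inner_eq_Re_hinner v_def q_def hinner_smult_left hinner_minus_left)
      then have "(\<lambda>s. inner (sgn y) (s *\<^sub>R v)) = (*) (- q / r)"
        by (simp add: fun_eq_iff sgn_div_norm r_def divide_inverse)
      ultimately have dn: "((\<lambda>s. norm (y + s *\<^sub>R v)) has_real_derivative - q / r) (at 0)"
        by (simp add: has_field_derivative_def)
      have "jacobian F (at y) *v v = (- c) *s F y"
        using h[of y] yb unfolding v_def vector_scalar_commute by simp
      \<comment> \<open>The real inner product sees only \<open>Re c = 1\<close>; the imaginary part
        of \<open>c\<close> merely rotates the phase of \<open>F y\<close>.\<close>
      then have "inner (F y) (jacobian F (at y) *v v) = - (norm (F y))\<^sup>2"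
        by (subst inner_commute)
           (simp add: inner_eq_Re_hinner hinner_smult_left hinner_minus_left hinner_self c)
      then have inn: "(\<lambda>s. inner (sgn (F y)) (jacobian F (at y) *v (s *\<^sub>R v))) = (*) (- norm (F y))"
        using nz[OF yb] by (simp add: fun_eq_iff sgn_div_norm power2_eq_square matrix_vector_mult_scaleR_complex)
      have dFv: "((\<lambda>s. F (y + s *\<^sub>R v)) has_derivative (\<lambda>s. jacobian F (at y) *v (s *\<^sub>R v))) (at 0)"
        using has_derivative_compose[OF line, of F] dF[of y] yb by simp
      have "((\<lambda>s. norm (F (y + s *\<^sub>R v))) has_derivative
          (\<lambda>s. inner (sgn (F y)) (jacobian F (at y) *v (s *\<^sub>R v)))) (at 0)"
        using has_derivative_compose[OF dFv, of norm "\<lambda>h. inner (sgn (F y)) h"] nz[OF yb]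
        by (simp add: has_derivative_norm inner_commute)
      then have dFn: "((\<lambda>s. norm (F (y + s *\<^sub>R v))) has_real_derivative - norm (F y)) (at 0)"
        unfolding inn by (simp add: has_field_derivative_def)
      have dK: "((\<lambda>s. K (norm (y + s *\<^sub>R v))) has_real_derivative k r * (- q / r)) (at 0)"
        by (rule DERIV_chain2[OF _ dn]) (use K(2) r in \<open>simp add: r_def\<close>)
      have "((\<lambda>s. \<Phi> (y + s *\<^sub>R v)) has_real_derivative
          - 1 - (- q / r) / r - k r * (- q / r) - \<epsilon> * (- q / r)) (at 0)"
        unfolding \<Phi>_def
        by (rule derivative_eq_intros dn dFn dK refl | use nz[OF yb] yb in \<open>simp add: r_def\<close>)+
      \<comment> \<open>The first summand is nonnegative by \<open>rad\<close>; the second supplies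
        strictness.\<close>
      moreover have "- 1 - (- q / r) / r - k r * (- q / r) - \<epsilon> * (- q / r)
          = (q * (1 + r * k r) - r\<^sup>2) / r\<^sup>2 + \<epsilon> * q / r"
        using r by (simp add: field_simps power2_eq_square)
      moreover have "\<dots> > 0" using q q0 r \<open>\<epsilon> > 0\<close> by (intro add_nonneg_pos) auto
      ultimately obtain d1 where d1: "d1 > 0" "\<And>s. 0 < s \<Longrightarrow> s < d1 \<Longrightarrow> \<Phi> y < \<Phi> (y + s *\<^sub>R v)"
        using DERIV_pos_inc_right[of "\<lambda>s. \<Phi> (y + s *\<^sub>R v)" _ 0] by auto
      obtain d2 where d2: "d2 > 0" "\<And>s. 0 < s \<Longrightarrow> s < d2 \<Longrightarrow> norm (y + s *\<^sub>R v) < norm y"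
        using DERIV_neg_dec_right[OF dn] q0 r by auto
      have "((\<lambda>s. norm (y + s *\<^sub>R v)) \<longlongrightarrow> norm y) (at_right 0)"
        by (auto intro!: tendsto_eq_intros)
      then have "\<forall>\<^sub>F s in at_right 0. \<delta> < norm (y + s *\<^sub>R v)"
        using yd(1) by (rule order_tendstoD)
      then obtain d3 where d3: "d3 > 0" "\<And>s. 0 < s \<Longrightarrow> s < d3 \<Longrightarrow> \<delta> < norm (y + s *\<^sub>R v)"
        by (auto simp: eventually_at_right_field)
      \<comment> \<open>The three bounds make \<open>\<Phi>\<close> grow, keep the new point inside
        the outer sphere and keep it outside the inner one.\<close>
      define s where "s = min d1 (min d2 d3) / 2"
      have s: "0 < s" "s < d1" "s < d2" "s < d3" using d1 d2 d3 by (auto simp: s_def)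
      have "y + s *\<^sub>R v \<in> X" using d2(2)[of s] d3(2)[of s] s yd by (auto simp: X_def)
      then show False using y(2) d1(2)[of s] s by fastforce
    qed
    then have "norm (F y - y) \<le> \<epsilon> * norm y" using d(2)[of y] \<delta> by simp
    then have "norm (F y) \<le> (1 + \<epsilon>) * norm y"
      using norm_triangle_ineq[of "F y - y" y] by (simp add: algebra_simps)
    then have "ln (norm (F y)) \<le> ln ((1 + \<epsilon>) * norm y)"
      using nz[OF yb] by (intro ln_mono) auto
    also have "\<dots> \<le> \<epsilon> + ln (norm y)"
      using yb \<open>\<epsilon> > 0\<close> ln_add_one_self_le_self[of \<epsilon>] by (simp add: ln_mult)
    finally have "\<Phi> y \<le> \<epsilon>"
      using K0[OF less_imp_le[OF r(1)] r(2)] mult_pos_pos[OF \<open>\<epsilon> > 0\<close> r(1)]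
      unfolding \<Phi>_def r_def by linarith
    then have "\<Phi> z \<le> \<epsilon>" using y(2)[OF zX] by simp
    then show ?thesis by (simp add: \<Phi>_def)
  qed
  have "ln (norm (F z)) - ln (norm z) - K (norm z) \<le> 0"
  proof (rule field_le_epsilon)
    fix e :: real assume "e > 0"
    then have "ln (norm (F z)) - ln (norm z) - K (norm z) \<le> e / 2 * norm z + e / 2"
      using pert[of "e / 2"] by simp
    also have "\<dots> \<le> e / 2 * 1 + e / 2"
      using z \<open>e > 0\<close> by (intro add_right_mono mult_left_mono) auto
    finally show "ln (norm (F z)) - ln (norm z) - K (norm z) \<le> 0 + e" by simp
  qed
  then have "ln (norm (F z)) \<le> ln (norm z * exp (K (norm z)))"
    using z by (simp add: ln_mult)
  then show ?thesis using z nz[OF z] by (simp add: ln_le_cancel_iff)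
qed

section \<open>Real-part bound for \<open>M_class\<close>\<close>

text \<open>On the complex line through \<open>z\<close>, with unit vector \<open>u\<close>, the
  expression in the class becomes a holomorphic function \<open>p\<close> of \<open>\<zeta>\<close>
  once the singularity at \<open>0\<close> is filled. The one-variable bound is then read off at the
  real point \<open>\<zeta> = norm z\<close>, where \<open>\<zeta> *s u = z\<close>.\<close>

lemma M_class_Re_ge:
  fixes h :: "complex ^ 'n \<Rightarrow> complex ^ 'n"
  assumes AB: "- 1 \<le> A" "A < B" "B \<le> 1" and \<alpha>: "\<alpha> < 1"
    and g: "\<And>\<xi>. \<xi> \<in> ball 0 1 \<Longrightarrow> g \<xi> = (1 + of_real A * \<xi>) / (1 + of_real B * \<xi>)"
    and h: "h \<in> M_class g \<alpha> \<beta>" and z: "z \<in> ball 0 1 - {0}"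
  shows "(1 + A * norm z) / (1 + B * norm z) \<le>
    Re ((- of_real \<alpha> + \<i> * of_real (tan \<beta>)) / (1 - of_real \<alpha>)
        + (1 - \<i> * of_real (tan \<beta>)) / (1 - of_real \<alpha>) * (hinner (h z) z / of_real ((norm z)\<^sup>2)))"
proof -
  define a where "a = (- of_real \<alpha> + \<i> * of_real (tan \<beta>)) / (1 - of_real \<alpha> :: complex)"
  define b where "b = (1 - \<i> * of_real (tan \<beta>)) / (1 - of_real \<alpha> :: complex)"
  have "1 - of_real \<alpha> \<noteq> (0 :: complex)" using \<alpha> by (simp add: complex_eq_iff)
  then have ab: "a + b = 1" by (simp add: a_def b_def field_simps)
  have hM: "holomorphic_map_on h (ball 0 1)" "h 0 = 0" "jacobian h (at 0) = mat 1"
    and range: "\<And>y. y \<in> ball 0 1 - {0} \<Longrightarrow> a + b * hinner (h y) (y /\<^sub>R (norm y)\<^sup>2) \<in> g ` ball 0 1"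
    using h by (auto simp: M_class_def a_def b_def)
  have r: "0 < norm z" "norm z < 1" using z by auto
  define u where "u = of_real (inverse (norm z)) *s z"
  have u: "norm u = 1" "of_real (norm z) *s u = z"
    using r by (simp_all add: u_def norm_smult vector_smult_assoc norm_inverse)
  then have uu: "hinner u u = 1" by (simp add: hinner_self)
  have ball: "\<zeta> *s u \<in> ball 0 1" if "norm \<zeta> < 1" for \<zeta>
    using that by (simp add: norm_smult u)
  define \<phi> where "\<phi> = (\<lambda>\<zeta>. hinner (h (\<zeta> *s u)) u)"
  have d\<phi>: "(\<phi> has_field_derivative hinner (jacobian h (at (\<zeta> *s u)) *v u) u) (at \<zeta>)"
    if "norm \<zeta> < 1" for \<zeta>
    unfolding \<phi>_def using has_field_derivative_hinner_line[OF hM(1) ball[OF that]] .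
  have \<phi>0: "\<phi> 0 = 0" by (simp add: \<phi>_def hM hinner_def)
  have "\<phi> holomorphic_on ball 0 1"
    unfolding holomorphic_on_open[OF open_ball] using d\<phi> by force
  moreover have "deriv \<phi> 0 = 1"
    using d\<phi>[of 0] by (intro DERIV_imp_deriv) (simp add: hM uu)
  \<comment> \<open>The normalization of \<open>h\<close> gives \<open>\<phi>\<close> a zero at
    \<open>0\<close> with derivative \<open>1\<close>, so the quotient extends by \<open>1\<close>;
    together with \<open>a + b = 1\<close> this yields \<open>p 0 = 1\<close>.\<close>
  ultimately have q: "(\<lambda>\<zeta>. if \<zeta> = 0 then 1 else \<phi> \<zeta> / \<zeta>) holomorphic_on ball 0 1"
    using pole_lemma_open[of \<phi> "ball 0 1" 0] by (simp add: \<phi>0 cong: if_cong)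
  define p where "p = (\<lambda>\<zeta>. a + b * (if \<zeta> = 0 then 1 else \<phi> \<zeta> / \<zeta>))"
  have p_eq: "p \<zeta> = a + b * hinner (h (\<zeta> *s u)) ((\<zeta> *s u) /\<^sub>R (norm (\<zeta> *s u))\<^sup>2)"
    if "\<zeta> \<noteq> 0" for \<zeta>
  proof -
    \<comment> \<open>The conjugate comes from the second argument of \<open>hinner\<close>;
      dividing by the squared norm turns it into the holomorphic factor
      \<open>1 / \<zeta>\<close>.\<close>
    have "cnj \<zeta> / of_real ((norm \<zeta>)\<^sup>2) = 1 / \<zeta>"
      using that by (simp add: complex_norm_square[symmetric] field_simps del: of_real_power)
    then show ?thesis using that
      by (simp add: p_def \<phi>_def scaleR_eq_smult hinner_smult_right norm_smult u vector_smult_assoc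
           field_simps)
  qed
  have "p holomorphic_on ball 0 1" unfolding p_def by (intro holomorphic_intros q)
  moreover have "p 0 = 1" by (simp add: p_def ab)
  moreover have "\<exists>\<xi>. norm \<xi> < 1 \<and> p \<zeta> = (1 + of_real A * \<xi>) / (1 + of_real B * \<xi>)"
    if \<zeta>: "norm \<zeta> < 1" for \<zeta>
  proof (cases "\<zeta> = 0")
    \<comment> \<open>The class condition excludes the origin; there \<open>p 0 = 1\<close> is the
      Moebius value at \<open>\<xi> = 0\<close>.\<close>
    case True
    then show ?thesis by (intro exI[of _ 0]) (simp add: p_def ab)
  next
    case False
    then have "\<zeta> *s u \<noteq> 0" using u(1) by (metis norm_smult mult_eq_0_iff norm_eq_zero zero_neq_one)
    then have "p \<zeta> \<in> g ` ball 0 1" using range[of "\<zeta> *s u"] ball[OF \<zeta>] p_eq[OF False] by simp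
    then show ?thesis using g by auto
  qed
  ultimately have "(1 + A * norm (complex_of_real (norm z))) / (1 + B * norm (complex_of_real (norm z)))
      \<le> Re (p (of_real (norm z)))"
    using AB r by (intro Re_subordinate_moebius_ge) auto
  moreover have "p (of_real (norm z)) = a + b * (hinner (h z) z / of_real ((norm z)\<^sup>2))"
    using r p_eq[of "of_real (norm z)"]
    by (simp add: u scaleR_eq_smult hinner_smult_right field_simps)
  ultimately show ?thesis by (simp add: a_def b_def)
qed

section \<open>The distortion estimate\<close>

text \<open>The bound is conditional because a nonpositive bracket makes its right-hand side at most
  \<open>0\<close> (division by \<open>0\<close> gives \<open>0\<close>), while the left-hand side
  is a quotient of nonzero norms.\<close>

theorem theorem3p3:
  fixes A B \<alpha> \<beta> :: real
    and g :: "complex \<Rightarrow> complex"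
    and F :: "complex ^ 'n \<Rightarrow> complex ^ 'n"
  assumes "- 1 \<le> A" and "A < B" and "B \<le> 1"
    and "0 \<le> \<alpha>" and "\<alpha> < 1"
    and "- (pi / 2) < \<beta>" and "\<beta> < pi / 2"
    and "\<And>\<xi>. \<xi> \<in> ball 0 1 \<Longrightarrow> g \<xi> = (1 + of_real A * \<xi>) / (1 + of_real B * \<xi>)"
    and "F \<in> S_class g \<alpha> \<beta>"
  shows "\<forall>z \<in> ball 0 1 - {0}. \<exists>v. norm v = 1 \<and>
    v = (matrix_inv (jacobian F (at z)) *v F z) /\<^sub>R norm (matrix_inv (jacobian F (at z)) *v F z) \<and>
    (0 < (1 + A * norm z) / (1 + B * norm z) - 1 / (1 - \<alpha>) * sqrt (\<alpha>\<^sup>2 + (tan \<beta>)\<^sup>2) \<longrightarrow>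
      norm (jacobian F (at z) *v v) \<le>
        (if A - A * \<alpha> + B * \<alpha> \<noteq> 0
         then (1 + (A - A * \<alpha> + B * \<alpha>) * norm z) powr ((B - A) * (1 - \<alpha>) / (A - A * \<alpha> + B * \<alpha>))
              / (((1 + A * norm z) / (1 + B * norm z) - 1 / (1 - \<alpha>) * sqrt (\<alpha>\<^sup>2 + (tan \<beta>)\<^sup>2))
                 * (1 - \<alpha>) * cos \<beta>)
         else exp ((B - A) * (1 - \<alpha>) * norm z)
              / (((1 + A * norm z) / (1 + B * norm z) - 1 / (1 - \<alpha>) * sqrt (\<alpha>\<^sup>2 + (tan \<beta>)\<^sup>2))
                 * (1 - \<alpha>) * cos \<beta>)))"
proof
  fix z :: "complex ^ 'n" assume z: "z \<in> ball 0 1 - {0}"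
  \<comment> \<open>From \<open>(1 - \<alpha>) * ((1 + A * r) / (1 + B * r)) + \<alpha> = (1 + C *
    r) / (1 + B * r)\<close>.\<close>
  define C where "C = A - A * \<alpha> + B * \<alpha>"
  define t where "t = tan \<beta>"
  define c where "c = 1 - \<i> * of_real t"
  define h where "h = (\<lambda>z. matrix_inv (jacobian F (at z)) *v F z)"
  note AB = assms(1-3) and \<alpha> = assms(4,5)
  have cos: "0 < cos \<beta>" using assms by (intro cos_gt_zero_pi) auto
  have F: "holomorphic_map_on F (ball 0 1)" "F 0 = 0" "jacobian F (at 0) = mat 1"
    and inv: "\<And>y. y \<in> ball 0 1 \<Longrightarrow> invertible (jacobian F (at y))"
    and hM: "h \<in> M_class g \<alpha> \<beta>"
    using assms(9) by (auto simp: S_class_def h_def)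
  have Jh: "jacobian F (at y) *v h y = F y" if "y \<in> ball 0 1" for y
  proof -
    have "jacobian F (at y) ** matrix_inv (jacobian F (at y)) = mat 1"
      using someI_ex[OF inv[OF that, unfolded invertible_def]] by (simp add: matrix_inv_def)
    then show ?thesis by (simp add: h_def matrix_vector_mul_assoc)
  qed
  have B1: "0 < 1 + B * r" and C1: "0 < 1 + C * r" if "0 \<le> r" "r < 1" for r
  proof -
    have "- 1 * r \<le> B * r" using AB that by (intro mult_right_mono) auto
    then show "0 < 1 + B * r" using that by simp
    \<comment> \<open>\<open>C\<close> is a convex combination of \<open>A\<close> and
      \<open>B\<close>, so \<open>C \<ge> A \<ge> - 1\<close>.\<close>
    have "A * \<alpha> \<le> B * \<alpha>" using AB \<alpha> by (intro mult_right_mono) auto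
    then have "- 1 * r \<le> C * r" using AB that by (intro mult_right_mono) (auto simp: C_def)
    then show "0 < 1 + C * r" using that by simp
  qed
  define W where "W = (\<lambda>y. (- of_real \<alpha> + \<i> * of_real t) / (1 - of_real \<alpha>)
        + c / (1 - of_real \<alpha>) * (hinner (h y) y / of_real ((norm y)\<^sup>2)))"
  have W: "(1 + A * norm y) / (1 + B * norm y) \<le> Re (W y)" if "y \<in> ball 0 1 - {0}" for y
    using M_class_Re_ge[OF AB \<alpha>(2) assms(8) hM that] by (simp add: W_def t_def c_def)
  have \<alpha>1: "1 - of_real \<alpha> \<noteq> (0 :: complex)" using \<alpha> by (simp add: complex_eq_iff)
  have hW: "c * hinner (h y) y
      = of_real ((norm y)\<^sup>2) * (of_real (1 - \<alpha>) * W y + of_real \<alpha> - \<i> * of_real t)"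
    if "y \<noteq> 0" for y
  proof -
    have "of_real (1 - \<alpha>) * W y
        = - of_real \<alpha> + \<i> * of_real t + c * (hinner (h y) y / of_real ((norm y)\<^sup>2))"
      using \<alpha>1 by (simp add: W_def distrib_left)
    then show ?thesis using that by simp
  qed
  have Re_h: "(norm y)\<^sup>2 * ((1 + C * norm y) / (1 + B * norm y)) \<le> Re (c * hinner (h y) y)"
    if y: "y \<in> ball 0 1 - {0}" for y
  proof -
    have "(1 + C * norm y) / (1 + B * norm y)
        = (1 - \<alpha>) * ((1 + A * norm y) / (1 + B * norm y)) + \<alpha>"
      using B1[of "norm y"] y by (simp add: C_def field_simps)
    also have "\<dots> \<le> (1 - \<alpha>) * Re (W y) + \<alpha>"
      using W[OF y] \<alpha> by (intro add_right_mono mult_left_mono) auto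
    finally have "(norm y)\<^sup>2 * ((1 + C * norm y) / (1 + B * norm y))
        \<le> (norm y)\<^sup>2 * ((1 - \<alpha>) * Re (W y) + \<alpha>)"
      by (rule mult_left_mono) simp
    also have "\<dots> = Re (c * hinner (h y) y)"
      using y by (subst hW) (auto simp del: of_real_power of_real_diff)
    finally show ?thesis .
  qed
  \<comment> \<open>Hence \<open>v\<close> can be normalized, and \<open>F\<close> has no zero off
    the origin, since \<open>h\<close> would vanish with it.\<close>
  have h0: "h y \<noteq> 0" if y: "y \<in> ball 0 1 - {0}" for y
  proof
    assume "h y = 0"
    moreover have "0 < (norm y)\<^sup>2 * ((1 + C * norm y) / (1 + B * norm y))"
      using y B1[of "norm y"] C1[of "norm y"] by simp
    ultimately show False using Re_h[OF y] by (simp add: hinner_def)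
  qed
  \<comment> \<open>\<open>k\<close> is chosen so that
    \<open>1 + r * k r = (1 + B * r) / (1 + C * r)\<close>, the reciprocal of the factor in
    \<open>Re_h\<close>; here \<open>B - C = (B - A) * (1 - \<alpha>)\<close>. \<open>K\<close> is
    the antiderivative of \<open>k\<close> vanishing at \<open>0\<close>, linear when
    \<open>C = 0\<close>.\<close>
  define K where "K = (\<lambda>r. if C \<noteq> 0 then (B - A) * (1 - \<alpha>) / C * ln (1 + C * r)
                              else (B - A) * (1 - \<alpha>) * r)"
  define k where "k = (\<lambda>r. (B - A) * (1 - \<alpha>) / (1 + C * r))"
  have growth: "norm (F z) \<le> norm z * exp (K (norm z))"
  proof (rule growth_bound[OF F Jh _ _ _ _ _ _ z])
    show "F y \<noteq> 0" if "y \<in> ball 0 1 - {0}" for y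
      using h0[OF that] by (auto simp: h_def)
    show "Re c = 1" "K 0 = 0" by (simp_all add: c_def K_def)
    show "(K has_real_derivative k r) (at r)" if "0 \<le> r" "r < 1" for r
    proof (cases "C = 0")
      case True
      then have "K = (\<lambda>r. (B - A) * (1 - \<alpha>) * r)" "k r = (B - A) * (1 - \<alpha>)"
        by (simp_all add: K_def k_def)
      then show ?thesis by (auto intro!: derivative_eq_intros)
    next
      case False
      then have "K = (\<lambda>r. (B - A) * (1 - \<alpha>) / C * ln (1 + C * r))" by (simp add: K_def)
      then show ?thesis using False C1[OF that]
        by (auto intro!: derivative_eq_intros simp: k_def)
    qed
    show "0 \<le> k r" if "0 \<le> r" "r < 1" for r
      using C1[OF that] AB \<alpha> by (simp add: k_def)
    show "(norm y)\<^sup>2 \<le> Re (c * hinner (h y) y) * (1 + norm y * k (norm y))"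
      if y: "y \<in> ball 0 1 - {0}" for y
    proof -
      have BC: "0 < 1 + B * norm y" "0 < 1 + C * norm y" using B1[of "norm y"] C1[of "norm y"] y by auto
      have "1 + norm y * k (norm y) = (1 + B * norm y) / (1 + C * norm y)"
        using BC by (simp add: k_def divide_simps) (simp add: C_def algebra_simps)
      then show ?thesis using mult_right_mono[OF Re_h[OF y], of "1 + norm y * k (norm y)"] BC by simp
    qed
  qed
  define X where "X = (1 + A * norm z) / (1 + B * norm z) - 1 / (1 - \<alpha>) * sqrt (\<alpha>\<^sup>2 + t\<^sup>2)"
  \<comment> \<open>The triangle inequality splits off \<open>\<alpha> - \<i> * t\<close>, whose
    modulus is the square root in \<open>X\<close>; Cauchy-Schwarz and
    \<open>norm c = 1 / cos \<beta>\<close> then lead to \<open>norm (h z)\<close>.\<close>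
  have norm_h: "norm z * (X * (1 - \<alpha>) * cos \<beta>) \<le> norm (h z)"
  proof -
    have "(norm c)\<^sup>2 = 1 + (tan \<beta>)\<^sup>2" by (simp add: c_def t_def cmod_power2)
    also have "\<dots> = (1 / cos \<beta>)\<^sup>2" using cos tan_sec[of \<beta>] by (simp add: inverse_eq_divide)
    finally have c: "norm c = 1 / cos \<beta>" using cos by (simp add: power2_eq_iff_nonneg)
    have "(1 - \<alpha>) * ((1 + A * norm z) / (1 + B * norm z)) \<le> (1 - \<alpha>) * norm (W z)"
      using W[OF z] complex_Re_le_cmod[of "W z"] \<alpha> by (intro mult_left_mono) auto
    also have "\<dots> = norm (of_real (1 - \<alpha>) * W z)" using \<alpha> by (simp add: norm_mult del: of_real_diff)
    also have "\<dots> \<le> norm (of_real (1 - \<alpha>) * W z + (of_real \<alpha> - \<i> * of_real t))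
        + norm (of_real \<alpha> - \<i> * of_real t)"
      by (rule order_trans[OF _ norm_triangle_ineq4]) simp
    finally have "(1 - \<alpha>) * ((1 + A * norm z) / (1 + B * norm z))
        \<le> norm (of_real (1 - \<alpha>) * W z + (of_real \<alpha> - \<i> * of_real t))
          + norm (of_real \<alpha> - \<i> * of_real t)" .
    moreover have "norm (of_real \<alpha> - \<i> * of_real t) = sqrt (\<alpha>\<^sup>2 + t\<^sup>2)" by (simp add: cmod_def)
    moreover have "X * (1 - \<alpha>) = (1 - \<alpha>) * ((1 + A * norm z) / (1 + B * norm z)) - sqrt (\<alpha>\<^sup>2 + t\<^sup>2)"
    proof -
      have "(m - 1 / (1 - \<alpha>) * s) * (1 - \<alpha>) = (1 - \<alpha>) * m - s" for m s
        using \<alpha> by (simp add: field_simps)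
      then show ?thesis by (simp only: X_def)
    qed
    ultimately have "X * (1 - \<alpha>) \<le> norm (of_real (1 - \<alpha>) * W z + (of_real \<alpha> - \<i> * of_real t))"
      by linarith
    then have "(norm z)\<^sup>2 * (X * (1 - \<alpha>))
        \<le> (norm z)\<^sup>2 * norm (of_real (1 - \<alpha>) * W z + (of_real \<alpha> - \<i> * of_real t))"
      by (rule mult_left_mono) simp
    also have "\<dots> = norm (c * hinner (h z) z)"
      using z by (subst hW) (auto simp: norm_mult norm_power add_diff_eq simp del: of_real_diff)
    also have "\<dots> \<le> 1 / cos \<beta> * (norm (h z) * norm z)"
      using norm_hinner_le[of "h z" z] cos by (simp add: norm_mult c divide_right_mono)
    finally have "norm z * (norm z * (X * (1 - \<alpha>))) \<le> norm z * (norm (h z) / cos \<beta>)"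
      by (simp add: power2_eq_square mult_ac)
    then have "norm z * (X * (1 - \<alpha>)) \<le> norm (h z) / cos \<beta>"
      using z by (subst (asm) mult_le_cancel_left_pos) auto
    then show ?thesis using cos by (simp add: pos_le_divide_eq mult_ac)
  qed
  define v where "v = h z /\<^sub>R norm (h z)"
  have "norm v = 1" using h0[OF z] by (simp add: v_def)
  moreover have "norm (jacobian F (at z) *v v) \<le> exp (K (norm z)) / (X * (1 - \<alpha>) * cos \<beta>)" if "0 < X"
  proof -
    have pos: "0 < X * (1 - \<alpha>) * cos \<beta>" using that \<alpha> cos by simp
    have "jacobian F (at z) *v v = F z /\<^sub>R norm (h z)"
      using Jh[of z] z by (simp add: v_def matrix_vector_mult_scaleR_complex)
    then have "norm (jacobian F (at z) *v v) = norm (F z) / norm (h z)"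
      by (simp add: divide_inverse mult.commute)
    \<comment> \<open>\<open>0 < X\<close> makes the lower bound \<open>norm_h\<close> positive, so
      it may replace the denominator; the factor \<open>norm z\<close> then cancels.\<close>
    also have "\<dots> \<le> (norm z * exp (K (norm z))) / (norm z * (X * (1 - \<alpha>) * cos \<beta>))"
      using growth norm_h pos z by (intro frac_le) auto
    also have "\<dots> = exp (K (norm z)) / (X * (1 - \<alpha>) * cos \<beta>)" using z by simp
    finally show ?thesis .
  qed
  moreover have "exp (K (norm z)) = (if C \<noteq> 0 then (1 + C * norm z) powr ((B - A) * (1 - \<alpha>) / C)
      else exp ((B - A) * (1 - \<alpha>) * norm z))"
    using C1[of "norm z"] z by (auto simp: K_def powr_def)
  ultimately show "\<exists>v. norm v = 1 \<and>
    v = (matrix_inv (jacobian F (at z)) *v F z) /\<^sub>R norm (matrix_inv (jacobian F (at z)) *v F z) \<and>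
    (0 < (1 + A * norm z) / (1 + B * norm z) - 1 / (1 - \<alpha>) * sqrt (\<alpha>\<^sup>2 + (tan \<beta>)\<^sup>2) \<longrightarrow>
      norm (jacobian F (at z) *v v) \<le>
        (if A - A * \<alpha> + B * \<alpha> \<noteq> 0
         then (1 + (A - A * \<alpha> + B * \<alpha>) * norm z) powr ((B - A) * (1 - \<alpha>) / (A - A * \<alpha> + B * \<alpha>))
              / (((1 + A * norm z) / (1 + B * norm z) - 1 / (1 - \<alpha>) * sqrt (\<alpha>\<^sup>2 + (tan \<beta>)\<^sup>2))
                 * (1 - \<alpha>) * cos \<beta>)
         else exp ((B - A) * (1 - \<alpha>) * norm z)
              / (((1 + A * norm z) / (1 + B * norm z) - 1 / (1 - \<alpha>) * sqrt (\<alpha>\<^sup>2 + (tan \<beta>)\<^sup>2))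
                 * (1 - \<alpha>) * cos \<beta>)))"
    unfolding C_def X_def t_def v_def h_def by (intro exI conjI impI) (auto split: if_splits)
qed

end
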